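(* For $i=1,2$ let $C_i$ be a signature, $c_i\in C_i^k$ a $k$-ary connective (same $k$ for both), and $M_i=(\mathbf A_i,D_i)$ a $C_i$-matrix with universe $A_i$. Let $\lambda:A_1\to A_2$ and $\mu:A_2\to A_1$ be functions such that: (a) $(\lambda,\mu)$ is an admissible pair; (b) $\lambda$ is an isomorphism from $\mathbf A_1/c_1$ to $\mathbf A_2/c_2$, i.e. $\lambda$ is a bijection and $\lambda(c_1^{\mathbf A_1}(x_1,\dots,x_k))=c_2^{\mathbf A_2}(\lambda(x_1),\dots,\lambda(x_k))$ for all $x_1,\dots,x_k\in A_1$; (c) $\mu=\lambda^{-1}$. Then $(\lambda,\mu)$ identifies $c_1$ with $c_2$: for every pair of $(c_1,c_2)$-associated formulas $\varphi_1,\varphi_2\in L(C_\circledast)$ with variables among $p_1,\dots,p_m$ and every $\vec a\in (A_\circledast)^m$, $\varphi_1(\vec a)\in D_\circledast$ if and only if $\varphi_2(\vec a)\in D_\circledast$, where $\varphi_j(\vec a)$ is the value of $\varphi_j$ at $\vec a$ in the algebra of the fibred matrix $(M_1\circledast M_2)_{(\lambda,\mu)}$.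
   Context: Fix a countable set $\mathcal V=\{p_1,p_2,\dots\}$ of propositional variables. A signature $C=\{C^k\}_{k\in\mathbb N}$ is a family of pairwise disjoint sets, disjoint from $\mathcal V$ ($C^k$ is the set of $k$-ary connectives); $L(C)$ is the absolutely free algebra over $C$ generated by $\mathcal V$. A $C$-matrix is $M=(\mathbf A,D)$ with $\mathbf A$ a $C$-algebra with universe $A$ and $D\subseteq A$. For a connective $c$, $\mathbf A/c$ is the algebra with universe $A$ whose only operation is $c^{\mathbf A}$. A pair $(\lambda,\mu)$ with $\lambda:A_1\to A_2$, $\mu:A_2\to A_1$ is admissible if for every $x\in A_1$: $\lambda(x)\in D_2$ iff $x\in D_1$; and for every $y\in A_2$: $\mu(y)\in D_1$ iff $y\in D_2$. Put $C_\circledast=C_1\uplus C_2$, $A_\circledast=A_1\uplus A_2$, $D_\circledast=D_1\uplus D_2$ (disjoint unions). Define $\ast_\lambda:A_\circledast\to A_2$ by $\ast_\lambda(x)=\lambda(x)$ if $x\in A_1$, $\ast_\lambda(x)=x$ if $x\in A_2$; and $\ast_\mu:A_\circledast\to A_1$ by $\ast_\mu(x)=x$ if $x\in A_1$, $\ast_\mu(x)=\mu(x)$ if $x\in A_2$. The fibred $C_\circledast$-matrix $(M_1\circledast M_2)_{(\lambda,\mu)}$ has universe $A_\circledast$, designated set $D_\circledast$, and operations $c(x_1,\dots,x_r)=c^{\mathbf A_1}(\ast_\mu(x_1),\dots,\ast_\mu(x_r))$ for $c\in C_1^r$ and $c(x_1,\dots,x_r)=c^{\mathbf A_2}(\ast_\lambda(x_1),\dots,\ast_\lambda(x_r))$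 for $c\in C_2^r$. Two formulas $\varphi_1,\varphi_2$ are closely $(c_1,c_2)$-associated if $\varphi_1=\varphi_2$, or $\varphi_2$ results from $\varphi_1$ by replacing exactly one occurrence of $c_1$ by $c_2$, or $\varphi_2$ results from $\varphi_1$ by replacing exactly one occurrence of $c_2$ by $c_1$. They are $(c_1,c_2)$-associated if there is a finite sequence $\psi_0,\dots,\psi_r$ of formulas with $\psi_0=\varphi_1$, $\psi_r=\varphi_2$ and $\psi_{j-1}$ closely $(c_1,c_2)$-associated to $\psi_j$ for $j=1,\dots,r$. *)

theory Defs
  imports Main "HOL-Library.FuncSet"
begin

text \<open>
  A signature assigns to each arity \<open>k\<close> its set of \<open>k\<close>-ary connectives. Disjointness from the
  propositional variables needs no clause, since variables and connectives are introduced by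
  different constructors of the type of formulas below.
\<close>

type_synonym 'c signature = "nat \<Rightarrow> 'c set"

definition is_signature :: "'c signature \<Rightarrow> bool" where
  "is_signature C \<longleftrightarrow> (\<forall>i j. i \<noteq> j \<longrightarrow> C i \<inter> C j = {})"

definition sig_union :: "'c signature \<Rightarrow> 'd signature \<Rightarrow> ('c + 'd) signature" where
  "sig_union C\<^sub>1 C\<^sub>2 = (\<lambda>k. C\<^sub>1 k <+> C\<^sub>2 k)"

text \<open>\<open>Var i\<close> is the propositional variable \<open>p\<^bsub>i+1\<^esub>\<close>. The type contains ill-formed terms; the
  formulas over \<open>C\<close> are the members of \<open>L C\<close>.\<close>

datatype 'c fm = Var nat | App 'c "'c fm list"

primrec vars :: "'c fm \<Rightarrow> nat set" where
  "vars (Var i) = {i}"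
| "vars (App c ts) = \<Union> (set (map vars ts))"

inductive_set L :: "'c signature \<Rightarrow> 'c fm set" for C :: "'c signature" where
  Var: "Var i \<in> L C"
| App: "\<lbrakk>c \<in> C (length ts); \<forall>t\<in>set ts. t \<in> L C\<rbrakk> \<Longrightarrow> App c ts \<in> L C"

text \<open>The interpretation of a \<open>k\<close>-ary connective matters only on lists of length \<open>k\<close> over the
  universe.\<close>

record ('c, 'a) algebra =
  universe :: "'a set"
  interp :: "'c \<Rightarrow> 'a list \<Rightarrow> 'a"

record ('c, 'a) matrix = "('c, 'a) algebra" +
  designated :: "'a set"

definition is_algebra :: "'c signature \<Rightarrow> ('c, 'a, 'r) algebra_scheme \<Rightarrow> bool" where
  "is_algebra C A \<longleftrightarrow>
    (\<forall>k. \<forall>c\<in>C k. \<forall>xs. length xs = k \<and> set xs \<subseteq> universe A \<longrightarrow> interp A c xs \<in> universe A)"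

definition is_matrix :: "'c signature \<Rightarrow> ('c, 'a) matrix \<Rightarrow> bool" where
  "is_matrix C M \<longleftrightarrow> is_algebra C M \<and> designated M \<subseteq> universe M"

text \<open>The value of a formula at the tuple \<open>as\<close>; the \<open>i\<close>-th component (from \<open>0\<close>) is assigned to
  \<open>Var i\<close>.\<close>

primrec val :: "('c, 'a, 'r) algebra_scheme \<Rightarrow> 'a list \<Rightarrow> 'c fm \<Rightarrow> 'a" where
  "val A as (Var i) = as ! i"
| "val A as (App c ts) = interp A c (map (val A as) ts)"

definition algebra_iso ::
  "'c signature \<Rightarrow> ('c, 'a, 'r) algebra_scheme \<Rightarrow> ('c, 'b, 's) algebra_scheme \<Rightarrow> ('a \<Rightarrow> 'b) \<Rightarrow> bool"
  where
  "algebra_iso C A B h \<longleftrightarrow>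
    bij_betw h (universe A) (universe B) \<and>
    (\<forall>k. \<forall>c\<in>C k. \<forall>xs. length xs = k \<and> set xs \<subseteq> universe A \<longrightarrow>
       h (interp A c xs) = interp B c (map h xs))"

text \<open>The reduct \<open>A/c\<close>. Its one connective is renamed to \<open>()\<close>, so that \<open>A/c\<close> and \<open>B/d\<close> are
  algebras over the same signature whenever \<open>c\<close> and \<open>d\<close> have the same arity.\<close>

definition single_sig :: "nat \<Rightarrow> unit signature" where
  "single_sig k = (\<lambda>n. if n = k then {()} else {})"

definition reduct :: "('c, 'a, 'r) algebra_scheme \<Rightarrow> 'c \<Rightarrow> (unit, 'a) algebra" where
  "reduct A c = \<lparr>universe = universe A, interp = (\<lambda>_. interp A c)\<rparr>"

definition admissible ::
  "('c, 'a) matrix \<Rightarrow> ('d, 'b) matrix \<Rightarrow> ('a \<Rightarrow> 'b) \<Rightarrow> ('b \<Rightarrow> 'a) \<Rightarrow> bool" where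
  "admissible M\<^sub>1 M\<^sub>2 l m \<longleftrightarrow>
    l \<in> universe M\<^sub>1 \<rightarrow> universe M\<^sub>2 \<and>
    m \<in> universe M\<^sub>2 \<rightarrow> universe M\<^sub>1 \<and>
    (\<forall>x\<in>universe M\<^sub>1. l x \<in> designated M\<^sub>2 \<longleftrightarrow> x \<in> designated M\<^sub>1) \<and>
    (\<forall>y\<in>universe M\<^sub>2. m y \<in> designated M\<^sub>1 \<longleftrightarrow> y \<in> designated M\<^sub>2)"

fun star_l :: "('a \<Rightarrow> 'b) \<Rightarrow> 'a + 'b \<Rightarrow> 'b" where
  "star_l l (Inl x) = l x"
| "star_l l (Inr y) = y"

fun star_m :: "('b \<Rightarrow> 'a) \<Rightarrow> 'a + 'b \<Rightarrow> 'a" where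
  "star_m m (Inl x) = x"
| "star_m m (Inr y) = m y"

fun fibred_interp ::
  "('c, 'a) matrix \<Rightarrow> ('d, 'b) matrix \<Rightarrow> ('a \<Rightarrow> 'b) \<Rightarrow> ('b \<Rightarrow> 'a) \<Rightarrow>
   'c + 'd \<Rightarrow> ('a + 'b) list \<Rightarrow> 'a + 'b" where
  "fibred_interp M\<^sub>1 M\<^sub>2 l m (Inl c) xs = Inl (interp M\<^sub>1 c (map (star_m m) xs))"
| "fibred_interp M\<^sub>1 M\<^sub>2 l m (Inr c) xs = Inr (interp M\<^sub>2 c (map (star_l l) xs))"

definition fibred ::
  "('c, 'a) matrix \<Rightarrow> ('d, 'b) matrix \<Rightarrow> ('a \<Rightarrow> 'b) \<Rightarrow> ('b \<Rightarrow> 'a) \<Rightarrow> ('c + 'd, 'a + 'b) matrix" where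
  "fibred M\<^sub>1 M\<^sub>2 l m =
    \<lparr>universe = universe M\<^sub>1 <+> universe M\<^sub>2,
     interp = fibred_interp M\<^sub>1 M\<^sub>2 l m,
     designated = designated M\<^sub>1 <+> designated M\<^sub>2\<rparr>"

text \<open>\<open>replace1 c d \<phi> \<psi>\<close>: replacing exactly one occurrence of \<open>c\<close> in \<open>\<phi>\<close> by \<open>d\<close> gives \<open>\<psi>\<close>. The
  occurrence is either the main connective or lies inside exactly one of the arguments.\<close>

inductive replace1 :: "'c \<Rightarrow> 'c \<Rightarrow> 'c fm \<Rightarrow> 'c fm \<Rightarrow> bool" for c d :: 'c where
  root: "replace1 c d (App c ts) (App d ts)"
| arg: "replace1 c d t t' \<Longrightarrow> replace1 c d (App f (us @ t # vs)) (App f (us @ t' # vs))"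

definition closely_associated :: "'c \<Rightarrow> 'c \<Rightarrow> 'c fm \<Rightarrow> 'c fm \<Rightarrow> bool" where
  "closely_associated c\<^sub>1 c\<^sub>2 \<phi>\<^sub>1 \<phi>\<^sub>2 \<longleftrightarrow>
    \<phi>\<^sub>1 = \<phi>\<^sub>2 \<or> replace1 c\<^sub>1 c\<^sub>2 \<phi>\<^sub>1 \<phi>\<^sub>2 \<or> replace1 c\<^sub>2 c\<^sub>1 \<phi>\<^sub>1 \<phi>\<^sub>2"

definition associated :: "'c signature \<Rightarrow> 'c \<Rightarrow> 'c \<Rightarrow> 'c fm \<Rightarrow> 'c fm \<Rightarrow> bool" where
  "associated C c\<^sub>1 c\<^sub>2 \<phi>\<^sub>1 \<phi>\<^sub>2 \<longleftrightarrow>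
    (\<exists>r \<psi>. \<psi> (0::nat) = \<phi>\<^sub>1 \<and> \<psi> r = \<phi>\<^sub>2 \<and> (\<forall>j\<le>r. \<psi> j \<in> L C) \<and>
       (\<forall>j\<in>{1..r}. closely_associated c\<^sub>1 c\<^sub>2 (\<psi> (j - 1)) (\<psi> j)))"

definition identifies ::
  "'c signature \<Rightarrow> 'd signature \<Rightarrow> ('c, 'a) matrix \<Rightarrow> ('d, 'b) matrix \<Rightarrow>
   ('a \<Rightarrow> 'b) \<Rightarrow> ('b \<Rightarrow> 'a) \<Rightarrow> 'c \<Rightarrow> 'd \<Rightarrow> bool" where
  "identifies C\<^sub>1 C\<^sub>2 M\<^sub>1 M\<^sub>2 l m c\<^sub>1 c\<^sub>2 \<longleftrightarrow>
    (\<forall>\<phi>\<^sub>1 \<in> L (sig_union C\<^sub>1 C\<^sub>2). \<forall>\<phi>\<^sub>2 \<in> L (sig_union C\<^sub>1 C\<^sub>2).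
       associated (sig_union C\<^sub>1 C\<^sub>2) (Inl c\<^sub>1) (Inr c\<^sub>2) \<phi>\<^sub>1 \<phi>\<^sub>2 \<longrightarrow>
       (\<forall>n as. vars \<phi>\<^sub>1 \<subseteq> {..<n} \<and> vars \<phi>\<^sub>2 \<subseteq> {..<n} \<and>
          length as = n \<and> set as \<subseteq> universe (fibred M\<^sub>1 M\<^sub>2 l m) \<longrightarrow>
          (val (fibred M\<^sub>1 M\<^sub>2 l m) as \<phi>\<^sub>1 \<in> designated (fibred M\<^sub>1 M\<^sub>2 l m) \<longleftrightarrow>
           val (fibred M\<^sub>1 M\<^sub>2 l m) as \<phi>\<^sub>2 \<in> designated (fibred M\<^sub>1 M\<^sub>2 l m))))"

end

theory Submission
  imports Defs
begin

text \<open>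
  Since \<open>\<mu> = \<lambda>\<inverse>\<close>, the map \<open>*\<^sub>\<lambda>\<close> glues every \<open>x \<in> A\<^sub>1\<close> to its copy \<open>\<lambda> x \<in> A\<^sub>2\<close>, and \<open>*\<^sub>\<mu>\<close> has the
  same kernel. Operations of the fibred matrix see their arguments only through these maps, so this
  kernel is a congruence; by admissibility it is compatible with the designated set. As \<open>\<lambda>\<close> is an
  isomorphism between the reducts, \<open>c\<^sub>1\<close> and \<open>c\<^sub>2\<close> give values glued together, hence replacing one
  by the other never changes the class of a value.
\<close>

lemma replace1_sym: "replace1 c d s t \<Longrightarrow> replace1 d c t s"
  by (induction rule: replace1.induct) (auto intro: replace1.intros)

lemma replace1_vars: "replace1 c d s t \<Longrightarrow> vars s = vars t"
  by (induction rule: replace1.induct) auto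

lemma closely_associated_vars: "closely_associated c d s t \<Longrightarrow> vars s = vars t"
  by (auto simp: closely_associated_def dest: replace1_vars)

lemma App_in_L_iff: "App c ts \<in> L C \<longleftrightarrow> c \<in> C (length ts) \<and> set ts \<subseteq> L C"
  by (subst L.simps) auto

lemma is_signature_arity_unique:
  "\<lbrakk>is_signature C; c \<in> C i; c \<in> C j\<rbrakk> \<Longrightarrow> i = j"
  by (auto simp: is_signature_def)

text \<open>The bound on the variables keeps each index in \<open>as ! i\<close> within the
  list.\<close>

lemma val_in_universe:
  assumes "is_algebra C A" and "t \<in> L C"
    and "vars t \<subseteq> {..<length as}" and "set as \<subseteq> universe A"
  shows "val A as t \<in> universe A"
  using assms(2,3)
proof (induction rule: L.induct)
  case (Var i)
  then show ?case using assms(4) by auto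
next
  case (App c ts)
  then have "set (map (val A as) ts) \<subseteq> universe A" by fastforce
  with App.hyps assms(1) show ?case by (simp add: is_algebra_def)
qed

lemma star_l_in_universe:
  "\<lbrakk>l \<in> U\<^sub>1 \<rightarrow> U\<^sub>2; x \<in> U\<^sub>1 <+> U\<^sub>2\<rbrakk> \<Longrightarrow> star_l l x \<in> U\<^sub>2"
  by auto

lemma star_m_in_universe:
  "\<lbrakk>m \<in> U\<^sub>2 \<rightarrow> U\<^sub>1; x \<in> U\<^sub>1 <+> U\<^sub>2\<rbrakk> \<Longrightarrow> star_m m x \<in> U\<^sub>1"
  by auto

text \<open>The star maps carry all arguments into the universe of the component that interprets the
  connective.\<close>

lemma is_algebra_fibred:
  assumes "is_algebra C\<^sub>1 M\<^sub>1" and "is_algebra C\<^sub>2 M\<^sub>2"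
    and "l \<in> universe M\<^sub>1 \<rightarrow> universe M\<^sub>2" and "m \<in> universe M\<^sub>2 \<rightarrow> universe M\<^sub>1"
  shows "is_algebra (sig_union C\<^sub>1 C\<^sub>2) (fibred M\<^sub>1 M\<^sub>2 l m)"
  unfolding is_algebra_def
proof (intro allI ballI impI, elim conjE)
  fix k c xs
  assume c: "c \<in> sig_union C\<^sub>1 C\<^sub>2 k" and len: "length xs = k"
    and "set xs \<subseteq> universe (fibred M\<^sub>1 M\<^sub>2 l m)"
  then have xs: "\<And>x. x \<in> set xs \<Longrightarrow> x \<in> universe M\<^sub>1 <+> universe M\<^sub>2"
    by (auto simp: fibred_def)
  have "set (map (star_l l) xs) \<subseteq> universe M\<^sub>2" "set (map (star_m m) xs) \<subseteq> universe M\<^sub>1"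
    using xs star_l_in_universe[OF assms(3)] star_m_in_universe[OF assms(4)] by auto
  with c len assms(1,2) show "interp (fibred M\<^sub>1 M\<^sub>2 l m) c xs \<in> universe (fibred M\<^sub>1 M\<^sub>2 l m)"
    by (auto simp: fibred_def sig_union_def is_algebra_def)
qed

text \<open>Both images are compared because \<open>c\<close> may come from either signature:
  \<open>Inl\<close> reads its arguments through \<open>star_m m\<close>, \<open>Inr\<close> through
  \<open>star_l l\<close>.\<close>

lemma fibred_interp_cong:
  assumes "map (star_l l) xs = map (star_l l) ys" and "map (star_m m) xs = map (star_m m) ys"
  shows "fibred_interp M\<^sub>1 M\<^sub>2 l m c xs = fibred_interp M\<^sub>1 M\<^sub>2 l m c ys"
  by (cases c) (simp_all add: assms del: map_eq_conv)

text \<open>The isomorphism of the reducts and the inverse are unpacked into equations: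
  \<open>m_l\<close> and \<open>l_m\<close> carry the bijectivity, \<open>hom\<close> the
  compatibility with \<open>c\<^sub>1\<close> and \<open>c\<^sub>2\<close>.\<close>

locale fibred_by_inverse =
  fixes C\<^sub>1 :: "'c signature" and C\<^sub>2 :: "'d signature"
    and c\<^sub>1 :: 'c and c\<^sub>2 :: 'd and k :: nat
    and M\<^sub>1 :: "('c, 'a) matrix" and M\<^sub>2 :: "('d, 'b) matrix"
    and l :: "'a \<Rightarrow> 'b" and m :: "'b \<Rightarrow> 'a"
  assumes signature: "is_signature C\<^sub>1"
    and connective: "c\<^sub>1 \<in> C\<^sub>1 k"
    and algebras: "is_algebra C\<^sub>1 M\<^sub>1" "is_algebra C\<^sub>2 M\<^sub>2"
    and adm: "admissible M\<^sub>1 M\<^sub>2 l m"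
    and m_l: "x \<in> universe M\<^sub>1 \<Longrightarrow> m (l x) = x"
    and l_m: "y \<in> universe M\<^sub>2 \<Longrightarrow> l (m y) = y"
    and hom: "\<lbrakk>length xs = k; set xs \<subseteq> universe M\<^sub>1\<rbrakk> \<Longrightarrow>
      l (interp M\<^sub>1 c\<^sub>1 xs) = interp M\<^sub>2 c\<^sub>2 (map l xs)"
begin

abbreviation C where "C \<equiv> sig_union C\<^sub>1 C\<^sub>2"

abbreviation M where "M \<equiv> fibred M\<^sub>1 M\<^sub>2 l m"

lemma l_m_fun:
  "l \<in> universe M\<^sub>1 \<rightarrow> universe M\<^sub>2" "m \<in> universe M\<^sub>2 \<rightarrow> universe M\<^sub>1"
  using adm by (auto simp: admissible_def)

text \<open>On the universe each star map determines the other; this and \<open>m_star_l\<close>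
  express the equality of their kernels.\<close>

lemma l_star_m: "x \<in> universe M \<Longrightarrow> l (star_m m x) = star_l l x"
  by (auto simp: fibred_def l_m)

lemma m_star_l: "x \<in> universe M \<Longrightarrow> m (star_l l x) = star_m m x"
  by (auto simp: fibred_def m_l)

text \<open>For \<open>Inl\<close> this is admissibility of \<open>l\<close>; for \<open>Inr\<close>
  the star map changes nothing.\<close>

lemma designated_iff: "x \<in> universe M \<Longrightarrow> x \<in> designated M \<longleftrightarrow> star_l l x \<in> designated M\<^sub>2"
  using adm by (auto simp: fibred_def admissible_def)

lemma val_in_universe_M:
  "\<lbrakk>t \<in> L C; vars t \<subseteq> {..<length as}; set as \<subseteq> universe M\<rbrakk> \<Longrightarrow> val M as t \<in> universe M"
  by (rule val_in_universe[OF is_algebra_fibred[OF algebras l_m_fun]])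

text \<open>The values themselves can differ: replacement at the root moves the value from the
  \<open>Inl\<close> summand to the \<open>Inr\<close> summand. Only the image under
  \<open>star_l l\<close> is invariant.\<close>

lemma star_l_replace1:
  assumes "replace1 (Inl c\<^sub>1) (Inr c\<^sub>2) s t" and "s \<in> L C" and "t \<in> L C"
    and "vars s \<subseteq> {..<length as}" and as: "set as \<subseteq> universe M"
  shows "star_l l (val M as s) = star_l l (val M as t)"
  using assms(1-4)
proof (induction rule: replace1.induct)
  case (root ts)
  let ?xs = "map (val M as) ts"
  \<comment> \<open>Membership in \<open>L C\<close> puts \<open>c\<^sub>1\<close> in
    \<open>C\<^sub>1 (length ts)\<close>; disjointness of the arities then forces the length that
    \<open>hom\<close> requires.\<close>
  have len: "length ts = k"
    using root.prems(1) signature connective is_signature_arity_unique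
    by (fastforce simp: App_in_L_iff sig_union_def)
  have xs: "x \<in> universe M" if "x \<in> set ?xs" for x
  proof -
    from that obtain t where "t \<in> set ts" "x = val M as t" by auto
    with root.prems show ?thesis
      by (auto simp: App_in_L_iff intro!: val_in_universe_M[OF _ _ as])
  qed
  have "star_m m x \<in> universe M\<^sub>1" if "x \<in> set ?xs" for x
    using xs[OF that] star_m_in_universe[OF l_m_fun(2)] by (simp add: fibred_def)
  then have "l (interp M\<^sub>1 c\<^sub>1 (map (star_m m) ?xs)) = interp M\<^sub>2 c\<^sub>2 (map l (map (star_m m) ?xs))"
    using len by (intro hom) auto
  also have "map l (map (star_m m) ?xs) = map (star_l l) ?xs"
    using xs by (auto simp: l_star_m)
  finally show ?case by (simp add: fibred_def)
next
  case (arg t t' f us vs)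
  have L: "t \<in> L C" "t' \<in> L C" and V: "vars t \<subseteq> {..<length as}"
    using arg.prems by (auto simp: App_in_L_iff)
  have V': "vars t' \<subseteq> {..<length as}" using V replace1_vars[OF arg.hyps] by simp
  have eq: "star_l l (val M as t) = star_l l (val M as t')"
    using L V by (rule arg.IH)
  \<comment> \<open>The outer connective \<open>f\<close> may lie in the first signature, so
    equality of the \<open>star_m m\<close> images is needed too; applying \<open>m\<close> yields
    it.\<close>
  then have "m (star_l l (val M as t)) = m (star_l l (val M as t'))" by simp
  then have "star_m m (val M as t) = star_m m (val M as t')"
    using L V V' as by (simp add: m_star_l val_in_universe_M)
  with eq have "fibred_interp M\<^sub>1 M\<^sub>2 l m f (map (val M as) (us @ t # vs))
      = fibred_interp M\<^sub>1 M\<^sub>2 l m f (map (val M as) (us @ t' # vs))"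
    by (intro fibred_interp_cong) auto
  then show ?case by (simp add: fibred_def)
qed

lemma star_l_closely_associated:
  assumes "closely_associated (Inl c\<^sub>1) (Inr c\<^sub>2) s t" and "s \<in> L C" and "t \<in> L C"
    and "vars s \<subseteq> {..<length as}" and "set as \<subseteq> universe M"
  shows "star_l l (val M as s) = star_l l (val M as t)"
  using assms(1) unfolding closely_associated_def
proof (elim disjE)
  assume "replace1 (Inr c\<^sub>2) (Inl c\<^sub>1) s t"
  with assms show ?thesis
    using star_l_replace1[OF replace1_sym] replace1_vars by metis
qed (use assms star_l_replace1 in auto)

lemma star_l_associated:
  assumes "associated C (Inl c\<^sub>1) (Inr c\<^sub>2) s t"
    and "vars s \<subseteq> {..<length as}" and "set as \<subseteq> universe M"
  shows "star_l l (val M as s) = star_l l (val M as t)"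
proof -
  obtain r \<psi> where \<psi>: "\<psi> (0::nat) = s" "\<psi> r = t" "\<And>j. j \<le> r \<Longrightarrow> \<psi> j \<in> L C"
    and close: "\<And>j. j \<in> {1..r} \<Longrightarrow> closely_associated (Inl c\<^sub>1) (Inr c\<^sub>2) (\<psi> (j - 1)) (\<psi> j)"
    using assms(1) unfolding associated_def by blast
  \<comment> \<open>Equality of the variable sets is carried through the induction, so that the
    bound on \<open>vars s\<close> also covers each intermediate formula.\<close>
  have "vars (\<psi> j) = vars s \<and> star_l l (val M as (\<psi> j)) = star_l l (val M as s)" if "j \<le> r" for j
    using that
  proof (induction j)
    case 0
    then show ?case by (simp add: \<psi>)
  next
    case (Suc j)
    have "closely_associated (Inl c\<^sub>1) (Inr c\<^sub>2) (\<psi> j) (\<psi> (Suc j))"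
      using close[of "Suc j"] Suc.prems by simp
    with Suc \<psi>(3) assms(2,3) show ?case
      using closely_associated_vars star_l_closely_associated
      by (metis Suc_leD)
  qed
  then show ?thesis using \<psi>(2) by auto
qed

text \<open>By \<open>designated_iff\<close> both sides ask whether a \<open>star_l l\<close> image
  lies in \<open>designated M\<^sub>2\<close>, and the two images coincide.\<close>

lemma identifies: "identifies C\<^sub>1 C\<^sub>2 M\<^sub>1 M\<^sub>2 l m c\<^sub>1 c\<^sub>2"
  unfolding identifies_def
  using star_l_associated designated_iff val_in_universe_M by metis

end

theorem theorem4p9:
  fixes C\<^sub>1 :: "'c signature" and C\<^sub>2 :: "'d signature"
    and c\<^sub>1 :: 'c and c\<^sub>2 :: 'd and k :: nat
    and M\<^sub>1 :: "('c, 'a) matrix" and M\<^sub>2 :: "('d, 'b) matrix"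
    and l :: "'a \<Rightarrow> 'b" and m :: "'b \<Rightarrow> 'a"
  assumes "is_signature C\<^sub>1" and "is_signature C\<^sub>2"
    and "c\<^sub>1 \<in> C\<^sub>1 k" and "c\<^sub>2 \<in> C\<^sub>2 k"
    and "is_matrix C\<^sub>1 M\<^sub>1" and "is_matrix C\<^sub>2 M\<^sub>2"
    and "admissible M\<^sub>1 M\<^sub>2 l m"
    and "algebra_iso (single_sig k) (reduct M\<^sub>1 c\<^sub>1) (reduct M\<^sub>2 c\<^sub>2) l"
    and "\<forall>y\<in>universe M\<^sub>2. m y = inv_into (universe M\<^sub>1) l y"
  shows "identifies C\<^sub>1 C\<^sub>2 M\<^sub>1 M\<^sub>2 l m c\<^sub>1 c\<^sub>2"
proof -
  have bij: "bij_betw l (universe M\<^sub>1) (universe M\<^sub>2)"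
    using assms(8) by (simp add: algebra_iso_def reduct_def)
  have "fibred_by_inverse C\<^sub>1 C\<^sub>2 c\<^sub>1 c\<^sub>2 k M\<^sub>1 M\<^sub>2 l m"
  proof
    show "is_algebra C\<^sub>1 M\<^sub>1" "is_algebra C\<^sub>2 M\<^sub>2"
      using assms(5,6) by (auto simp: is_matrix_def)
    \<comment> \<open>The formula for \<open>m\<close> is given on \<open>universe M\<^sub>2\<close>
      only, so \<open>bij\<close> must first place \<open>l x\<close> there.\<close>
    show "m (l x) = x" if "x \<in> universe M\<^sub>1" for x
      using assms(9) bij that by (simp add: bij_betw_inv_into_left bij_betw_apply)
    show "l (m y) = y" if "y \<in> universe M\<^sub>2" for y
      using assms(9) bij that by (simp add: bij_betw_inv_into_right)
    show "l (interp M\<^sub>1 c\<^sub>1 xs) = interp M\<^sub>2 c\<^sub>2 (map l xs)"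
      if "length xs = k" "set xs \<subseteq> universe M\<^sub>1" for xs
      using assms(8) that by (auto simp: algebra_iso_def reduct_def single_sig_def)
  qed (use assms in auto)
  then show ?thesis by (rule fibred_by_inverse.identifies)
qed

end
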